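(* For every positive integer $n$, $m(n) \leq n \lceil \log_2 n \rceil$.
   Context: For a set $V$, $\binom{V}{k}$ denotes the family of $k$-element subsets of $V$. A bi-coloured system is a pair $\mathcal{S} = (V,f)$ where $V$ is a finite set of points and $f : \binom{V}{3} \to \{R,B\}$ is any function. For $\{u,v\} \in \binom{V}{2}$, the red line and blue line generated by $u,v$ are $$R_{\mathcal{S}}(uv) = \{u,v\} \cup \{p : f(\{u,v,p\}) = R\}, \qquad B_{\mathcal{S}}(uv) = \{u,v\} \cup \{p : f(\{u,v,p\}) = B\}.$$ Let $m_{\mathcal{S}}(R)$ and $m_{\mathcal{S}}(B)$ be the numbers of distinct red lines and distinct blue lines respectively, and $m_{\mathcal{S}} = m_{\mathcal{S}}(R) + m_{\mathcal{S}}(B)$ (red and blue lines are counted separately, even if a red line and a blue line are equal as sets). Finally, $m(n)$ is the minimum of $m_{\mathcal{S}}$ over all bi-coloured systems $\mathcal{S}=(V,f)$ with $|V| = n$. *)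

theory Defs
  imports Complex_Main
begin

datatype colour = Red | Blue

text \<open>A bi-coloured system on a finite set \<open>V\<close> is given by a total function \<open>f\<close> on sets of points.
  Only the values of \<open>f\<close> on the 3-element subsets of \<open>V\<close> are ever used, so its values elsewhere
  do not matter.\<close>

definition line :: "'a set \<Rightarrow> ('a set \<Rightarrow> colour) \<Rightarrow> colour \<Rightarrow> 'a \<Rightarrow> 'a \<Rightarrow> 'a set" where
  "line V f c u v = {u, v} \<union> {p \<in> V - {u, v}. f {u, v, p} = c}"

definition lines :: "'a set \<Rightarrow> ('a set \<Rightarrow> colour) \<Rightarrow> colour \<Rightarrow> 'a set set" where
  "lines V f c = {line V f c u v | u v. u \<in> V \<and> v \<in> V \<and> u \<noteq> v}"

definition num_lines :: "'a set \<Rightarrow> ('a set \<Rightarrow> colour) \<Rightarrow> nat" where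
  "num_lines V f = card (lines V f Red) + card (lines V f Blue)"

text \<open>The minimum is taken over systems whose points are natural numbers; the lemma after the
  definition shows that it is a lower bound for systems with points of any type.\<close>

definition min_lines :: "nat \<Rightarrow> nat" where
  "min_lines n = (LEAST k. \<exists>(V :: nat set) f. finite V \<and> card V = n \<and> num_lines V f = k)"

lemma min_lines_le_num_lines:
  fixes V :: "'a set"
  assumes "finite V"
  shows "min_lines (card V) \<le> num_lines V f"
proof -
  obtain h :: "'a \<Rightarrow> nat" where h: "inj_on h V"
    using assms finite_imp_inj_to_nat_seg by blast
  define W where "W = h ` V"
  define g where "g = (\<lambda>T. f (inv_into V h ` T))"
  have g: "g {h u, h v, h p} = f {u, v, p}" if "u \<in> V" "v \<in> V" "p \<in> V" for u v p
    using that h by (simp add: g_def)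
  have line: "line W g c (h u) (h v) = h ` line V f c u v"
    if "u \<in> V" "v \<in> V" for c u v
    using that h g unfolding line_def W_def by (auto simp: inj_on_eq_iff)
  have "lines W g c = (`) h ` lines V f c" for c
  proof (intro equalityI subsetI)
    fix L assume "L \<in> lines W g c"
    then obtain u v where "u \<in> V" "v \<in> V" "h u \<noteq> h v" "L = line W g c (h u) (h v)"
      by (auto simp: lines_def W_def)
    moreover from this have "line V f c u v \<in> lines V f c"
      unfolding lines_def by blast
    ultimately show "L \<in> (`) h ` lines V f c"
      using line by simp
  next
    fix L assume "L \<in> (`) h ` lines V f c"
    then obtain u v where uv: "u \<in> V" "v \<in> V" "u \<noteq> v" "L = h ` line V f c u v"
      by (auto simp: lines_def)
    then have "h u \<noteq> h v" "h u \<in> W" "h v \<in> W" "L = line W g c (h u) (h v)"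
      using h line by (auto simp: inj_on_eq_iff W_def)
    then show "L \<in> lines W g c"
      unfolding lines_def by blast
  qed
  moreover have "lines V f c \<subseteq> Pow V" for c
    by (auto simp: lines_def line_def)
  then have "inj_on ((`) h) (lines V f c)" for c
    using h by (meson inj_on_image_Pow inj_on_subset)
  ultimately have "num_lines W g = num_lines V f"
    by (simp add: num_lines_def card_image)
  moreover have "finite W" "card W = card V"
    using assms h by (simp_all add: W_def card_image)
  ultimately show ?thesis
    unfolding min_lines_def by (intro Least_le) blast
qed

end

theory Submission
  imports Defs
begin

text \<open>Take the points as leaves of a balanced binary tree, and colour a triple by whether the node
  that first separates it sends two of the points left (red) or right (blue). If \<open>u\<close> lies left and
  \<open>v\<close> right of a node, the red line of \<open>uv\<close> depends only on the node and \<open>v\<close>, the blue line only on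
  the node and \<open>u\<close>; so each node accounts for at most as many lines as it has leaves below it, and
  the total is at most the sum of the leaf depths.\<close>

lemma line_commute: "line V f c u v = line V f c v u"
  by (simp add: line_def insert_commute)

lemma finite_lines: "finite V \<Longrightarrow> finite (lines V f c)"
  by (rule finite_subset[of _ "Pow V"]) (auto simp: lines_def line_def)

text \<open>Shaped for \<open>lines_join_colouring\<close>: lines of one side altered, lines of the
  other side kept, and one new line per point of a side.\<close>

lemma card_Un3_image_le:
  assumes "finite X" "finite Y" "finite Z"
  shows "card (g ` X \<union> Y \<union> h ` Z) \<le> card X + card Y + card Z"
proof -
  have "card (g ` X \<union> Y \<union> h ` Z) \<le> card (g ` X) + card Y + card (h ` Z)"
    by (meson add_mono card_Un_le le_refl le_trans)
  also have "\<dots> \<le> card X + card Y + card Z"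
    using assms by (intro add_mono card_image_le le_refl)
  finally show ?thesis .
qed

text \<open>A tree node with \<open>A\<close> on its left and \<open>B\<close> on its right. A
  triple meeting both disjoint sides has two points on exactly one of them, and the last test finds
  which.\<close>

definition join_colouring ::
    "'a set \<Rightarrow> 'a set \<Rightarrow> ('a set \<Rightarrow> colour) \<Rightarrow> ('a set \<Rightarrow> colour) \<Rightarrow> 'a set \<Rightarrow> colour" where
  "join_colouring A B g h T =
    (if T \<subseteq> A then g T else if T \<subseteq> B then h T else if card (T \<inter> A) = 2 then Red else Blue)"

lemma join_colouring_within [simp]:
  "T \<subseteq> A \<Longrightarrow> join_colouring A B g h T = g T"
  "A \<inter> B = {} \<Longrightarrow> T \<noteq> {} \<Longrightarrow> T \<subseteq> B \<Longrightarrow> join_colouring A B g h T = h T"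
  by (auto simp: join_colouring_def)

lemma join_colouring_across:
  assumes "A \<inter> B = {}" "u \<noteq> v"
  shows "u \<in> A \<Longrightarrow> v \<in> A \<Longrightarrow> p \<in> B \<Longrightarrow> join_colouring A B g h {u, v, p} = Red"
    and "u \<in> B \<Longrightarrow> v \<in> B \<Longrightarrow> p \<in> A \<Longrightarrow> join_colouring A B g h {u, v, p} = Blue"
proof -
  assume "u \<in> A" "v \<in> A" "p \<in> B"
  moreover from this have "{u, v, p} \<inter> A = {u, v}"
    using assms by blast
  ultimately show "join_colouring A B g h {u, v, p} = Red"
    using assms by (auto simp: join_colouring_def)
next
  assume "u \<in> B" "v \<in> B" "p \<in> A"
  moreover from this have "{u, v, p} \<inter> A = {p}"
    using assms by blast
  ultimately show "join_colouring A B g h {u, v, p} = Blue"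
    using assms by (auto simp: join_colouring_def)
qed

text \<open>Two points of \<open>A\<close> form a red triple with every point of \<open>B\<close>.
  So each new line is determined by the old one, and pairs inside \<open>A\<close> generate no more
  lines than before.\<close>

lemma line_join_colouring_left:
  assumes "A \<inter> B = {}" "u \<in> A" "v \<in> A" "u \<noteq> v"
  shows "line (A \<union> B) (join_colouring A B g h) Red u v = line A g Red u v \<union> B"
    and "line (A \<union> B) (join_colouring A B g h) Blue u v = line A g Blue u v"
  using assms by (auto simp: line_def join_colouring_across)

lemma line_join_colouring_right:
  assumes "A \<inter> B = {}" "u \<in> B" "v \<in> B" "u \<noteq> v"
  shows "line (A \<union> B) (join_colouring A B g h) Red u v = line B h Red u v"
    and "line (A \<union> B) (join_colouring A B g h) Blue u v = line B h Blue u v \<union> A"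
  using assms by (auto simp: line_def join_colouring_across)

text \<open>The third point decides the majority: red if it is in \<open>A\<close>, blue if in
  \<open>B\<close>. Hence the red line forgets \<open>u\<close> and the blue line forgets
  \<open>v\<close>, so all crossing pairs together yield at most \<open>card B\<close> red and
  \<open>card A\<close> blue lines.\<close>

lemma line_join_colouring_across:
  assumes "A \<inter> B = {}" "u \<in> A" "v \<in> B"
  shows "line (A \<union> B) (join_colouring A B g h) Red u v = insert v A"
    and "line (A \<union> B) (join_colouring A B g h) Blue u v = insert u B"
proof -
  \<comment> \<open>The two points on the same side are now \<open>u\<close> and \<open>p\<close>,
    so the triple is reordered to put them first.\<close>
  have A: "join_colouring A B g h {u, v, p} = Red" if "p \<in> A" "p \<noteq> u" for p
    using join_colouring_across(1)[of A B u p v g h] assms that by (simp add: insert_commute)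
  have B: "join_colouring A B g h {u, v, p} = Blue" if "p \<in> B" "p \<noteq> v" for p
    using join_colouring_across(2)[of A B v p u g h] assms that by (simp add: insert_commute)
  show "line (A \<union> B) (join_colouring A B g h) Red u v = insert v A"
    and "line (A \<union> B) (join_colouring A B g h) Blue u v = insert u B"
    using assms by (auto simp: line_def A B)
qed

lemma lines_join_colouring:
  fixes g h :: "'a set \<Rightarrow> colour"
  assumes "A \<inter> B = {}"
  defines "f \<equiv> join_colouring A B g h"
  shows "lines (A \<union> B) f Red
      \<subseteq> (\<lambda>L. L \<union> B) ` lines A g Red \<union> lines B h Red \<union> (\<lambda>v. insert v A) ` B" (is "_ \<subseteq> ?R")
    and "lines (A \<union> B) f Blue
      \<subseteq> (\<lambda>L. L \<union> A) ` lines B h Blue \<union> lines A g Blue \<union> (\<lambda>u. insert u B) ` A" (is "_ \<subseteq> ?B")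
proof -
  have within: "line V k c u v \<in> lines V k c"
    if "u \<in> V" "v \<in> V" "u \<noteq> v" for V :: "'a set" and k c u v
    using that unfolding lines_def by blast
  have *: "line (A \<union> B) f Red u v \<in> ?R \<and> line (A \<union> B) f Blue u v \<in> ?B"
    if uv: "u \<in> A \<union> B" "v \<in> A \<union> B" "u \<noteq> v" for u v
  proof -
    consider "u \<in> A" "v \<in> A" | "u \<in> B" "v \<in> B" | "u \<in> A" "v \<in> B" | "v \<in> A" "u \<in> B"
      using uv by blast
    then show ?thesis
    proof cases
      case 1
      then show ?thesis
        using uv assms(1) by (simp add: f_def line_join_colouring_left within)
    next
      case 2
      then show ?thesis
        using uv assms(1) by (simp add: f_def line_join_colouring_right within)
    next
      case 3
      then show ?thesis
        using assms(1) by (simp add: f_def line_join_colouring_across)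
    next
      case 4
      then show ?thesis
        using assms(1) by (simp add: f_def line_join_colouring_across line_commute[of _ _ _ u v])
    qed
  qed
  show "lines (A \<union> B) f Red \<subseteq> ?R" "lines (A \<union> B) f Blue \<subseteq> ?B"
    using * by (auto simp only: lines_def)
qed

text \<open>The cost of one node: \<open>card B\<close> new red lines plus \<open>card A\<close> new
  blue ones.\<close>

lemma num_lines_join_colouring:
  assumes "finite A" "finite B" "A \<inter> B = {}"
  shows "num_lines (A \<union> B) (join_colouring A B g h)
    \<le> num_lines A g + num_lines B h + card (A \<union> B)"
proof -
  note fin = finite_lines[OF assms(1)] finite_lines[OF assms(2)] assms(1,2)
  have "card (lines (A \<union> B) (join_colouring A B g h) Red)
      \<le> card (lines A g Red) + card (lines B h Red) + card B"
    by (rule order.trans[OF card_mono[OF _ lines_join_colouring(1)] card_Un3_image_le])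
      (simp_all add: fin assms(3))
  moreover have "card (lines (A \<union> B) (join_colouring A B g h) Blue)
      \<le> card (lines B h Blue) + card (lines A g Blue) + card A"
    by (rule order.trans[OF card_mono[OF _ lines_join_colouring(2)] card_Un3_image_le])
      (simp_all add: fin assms(3))
  ultimately show ?thesis
    using assms by (simp add: num_lines_def card_Un_disjoint)
qed

text \<open>Here \<open>k\<close> bounds the depth of the tree; the nodes of one level have disjoint
  leaf sets, so each level costs at most \<open>card V\<close>.\<close>

lemma exists_colouring_num_lines_le:
  fixes V :: "'a set"
  assumes "finite V" "card V \<le> 2 ^ k"
  shows "\<exists>f. num_lines V f \<le> card V * k"
  using assms
proof (induction k arbitrary: V)
  \<comment> \<open>At most one point, hence no pair to generate a line.\<close>
  case 0
  then have "lines V f c = {}" for f c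
    by (auto simp: lines_def card_le_Suc0_iff_eq)
  then show ?case
    by (simp add: num_lines_def)
next
  case (Suc k)
  obtain A where A: "A \<subseteq> V" "card A = card V div 2"
    using obtain_subset_with_card_n[of "card V div 2" V] by auto
  define B where "B = V - A"
  have V: "V = A \<union> B" "A \<inter> B = {}" and fin: "finite A" "finite B"
    using A Suc.prems(1) by (auto simp: B_def finite_subset)
  have card_V: "card V = card A + card B"
    using V fin by (simp add: card_Un_disjoint)
  \<comment> \<open>\<open>B\<close> may be the larger half, with \<open>card V\<close> halved and
    rounded up; the bound survives because \<open>2 ^ Suc k\<close> is even.\<close>
  then have "card A \<le> 2 ^ k" "card B \<le> 2 ^ k"
    using A Suc.prems(2) by auto
  then obtain g h where "num_lines A g \<le> card A * k" "num_lines B h \<le> card B * k"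
    using Suc.IH fin by meson
  then have "num_lines V (join_colouring A B g h) \<le> card A * k + card B * k + card V"
    using num_lines_join_colouring[OF fin V(2), of g h] V(1) by simp
  also have "\<dots> = card V * Suc k"
    by (simp add: card_V algebra_simps)
  finally show ?case
    by blast
qed

theorem theorem2:
  fixes n :: nat
  assumes "n \<ge> 1"
  shows "int (min_lines n) \<le> int n * \<lceil>log 2 (real n)\<rceil>"
proof -
  \<comment> \<open>The least depth with room for \<open>n\<close> leaves. As
    \<open>n \<ge> 1\<close>, the ceiling is nonnegative and \<open>nat\<close> truncates
    nothing.\<close>
  define k where "k = nat \<lceil>log 2 (real n)\<rceil>"
  have "log 2 (real n) \<ge> 0"
    using assms by simp
  then have k: "int k = \<lceil>log 2 (real n)\<rceil>"
    unfolding k_def by simp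
  have "log 2 (real n) \<le> real k"
    unfolding k_def by (rule real_nat_ceiling_ge)
  then have "real n \<le> 2 powr real k"
    using assms by (simp add: log_le_iff)
  then have "real n \<le> real (2 ^ k)"
    by (simp add: powr_realpow)
  then have "n \<le> 2 ^ k"
    by (simp only: of_nat_le_iff)
  then obtain f where "num_lines {..<n} f \<le> n * k"
    using exists_colouring_num_lines_le[of "{..<n}" k] by auto
  then have "min_lines n \<le> n * k"
    using min_lines_le_num_lines[of "{..<n}" f] by simp
  then show ?thesis
    unfolding k[symmetric] of_nat_mult[symmetric] by (simp only: of_nat_le_iff)
qed

end
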